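(* For every $h>0$ and all $a,b\in\mathbb{R}_+$, one has $a\mathbin{\nabla_h}b=\{c\in\mathbb{R}_+\mid |a^{1/h}-b^{1/h}|^h\le c\le(a^{1/h}+b^{1/h})^h\}$, and, for fixed $a,b\in\mathbb{R}_+$, the endpoints of the segment $a\mathbin{\nabla_h}b$ tend to the endpoints of the segment $a\curlyvee b$ as $h\to0^+$: if $a\ne b$, then $\lim_{h\to0^+}|a^{1/h}-b^{1/h}|^h=\lim_{h\to0^+}(a^{1/h}+b^{1/h})^h=\max(a,b)$; and if $a=b$, then $|a^{1/h}-b^{1/h}|^h=0$ for all $h>0$ and $\lim_{h\to0^+}(a^{1/h}+b^{1/h})^h=a$.
   Context: $\mathbb{R}_+=[0,\infty)$. The triangle addition on $\mathbb{R}_+$ is $a\mathbin{\nabla}b=\{c\in\mathbb{R}_+\mid|a-b|\le c\le a+b\}$. For $h>0$ let $R_h:\mathbb{R}_+\to\mathbb{R}_+$, $R_h(x)=x^{1/h}$ (with $0\mapsto 0$), with inverse $R_h^{-1}(x)=x^h$, and define $a\mathbin{\nabla_h}b=R_h^{-1}(R_h(a)\mathbin{\nabla}R_h(b))$. The ultratriangle addition on $\mathbb{R}_+$ is $a\curlyvee b=\{\max(a,b)\}$ if $a\ne b$, and $a\curlyvee a=\{x\in\mathbb{R}_+\mid x\le a\}=[0,a]$ (a one-point set is regarded as a degenerate segment). *)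

theory Defs
  imports "HOL-Analysis.Analysis"
begin

text \<open>Elements of the half-line \<open>[0,\<infinity>)\<close> are reals assumed nonnegative;
  multivalued operations return subsets of the half-line.\<close>

definition tri_add :: "real \<Rightarrow> real \<Rightarrow> real set" where
  "tri_add a b = {c. 0 \<le> c \<and> \<bar>a - b\<bar> \<le> c \<and> c \<le> a + b}"

text \<open>Since \<open>0 powr t = 0\<close> for every \<open>t\<close>, both maps send 0 to 0.\<close>

definition R_map :: "real \<Rightarrow> real \<Rightarrow> real" where
  "R_map h x = x powr (1 / h)"

definition R_inv :: "real \<Rightarrow> real \<Rightarrow> real" where
  "R_inv h x = x powr h"

lemma R_inv_R_map: "0 < h \<Longrightarrow> 0 \<le> x \<Longrightarrow> R_inv h (R_map h x) = x"
  by (simp add: R_inv_def R_map_def powr_powr)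

lemma R_map_R_inv: "0 < h \<Longrightarrow> 0 \<le> x \<Longrightarrow> R_map h (R_inv h x) = x"
  by (simp add: R_inv_def R_map_def powr_powr)

definition tri_add_h :: "real \<Rightarrow> real \<Rightarrow> real \<Rightarrow> real set" where
  "tri_add_h h a b = R_inv h ` tri_add (R_map h a) (R_map h b)"

definition ultra_add :: "real \<Rightarrow> real \<Rightarrow> real set" where
  "ultra_add a b = (if a \<noteq> b then {max a b} else {x. 0 \<le> x \<and> x \<le> a})"

text \<open>A one-point set is a segment with equal endpoints.\<close>

definition segment_with_endpoints :: "real set \<Rightarrow> real \<Rightarrow> real \<Rightarrow> bool" where
  "segment_with_endpoints S l u \<longleftrightarrow> l \<le> u \<and> S = {l..u}"

end

(* With M = max a b and t = min a b / M, the endpoints are M * (1 - t^(1/h))^h and M * (1 + t^(1/h))^h.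
   If t < 1, then t^(1/h) tends to 0 and both tend to M; if t = 1, they are 0 and 2^h * M, which tends to M. *)
theory Submission
  imports Defs
begin

text \<open>\<open>R_inv h\<close> is an increasing bijection of the half-line with inverse
  \<open>R_map h\<close>, so it carries a segment onto the segment between the images of its
  endpoints.\<close>

lemma tri_add_h_eq:
  assumes h: "0 < h"
  shows "tri_add_h h a b =
    {\<bar>a powr (1/h) - b powr (1/h)\<bar> powr h .. (a powr (1/h) + b powr (1/h)) powr h}"
    (is "_ = {?L powr h .. ?U powr h}")
proof
  show "tri_add_h h a b \<subseteq> {?L powr h .. ?U powr h}"
    using h by (auto simp: tri_add_h_def tri_add_def R_map_def R_inv_def intro!: powr_mono2)
next
  show "{?L powr h .. ?U powr h} \<subseteq> tri_add_h h a b"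
  proof
    fix c
    assume c: "c \<in> {?L powr h .. ?U powr h}"
    then have c0: "0 \<le> c"
      by (meson atLeastAtMost_iff order_trans powr_ge_zero)
    have root_powr: "(x powr h) powr (1/h) = x" if "0 \<le> x" for x
      using R_map_R_inv[OF h that] by (simp add: R_map_def R_inv_def)
    \<comment> \<open>Both bounds on \<open>c\<close> are pulled back through the increasing map
      \<open>R_map h\<close>; this makes \<open>R_map h c\<close> the preimage of \<open>c\<close>
      in the triangle sum.\<close>
    have "?L \<le> c powr (1/h)"
      using powr_mono2[of "1/h" "?L powr h" c] c h by (simp add: root_powr)
    moreover have "c powr (1/h) \<le> ?U"
      using powr_mono2[of "1/h" c "?U powr h"] c c0 h by (simp add: root_powr)
    ultimately have "R_map h c \<in> tri_add (R_map h a) (R_map h b)"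
      by (simp add: tri_add_def R_map_def)
    then show "c \<in> tri_add_h h a b"
      using R_inv_R_map[OF h c0] unfolding tri_add_h_def by (metis imageI)
  qed
qed

text \<open>For \<open>t > 0\<close> the power is \<open>exp (ln t / h)\<close> with
  \<open>ln t < 0\<close>, so the exponent goes to minus infinity. The case \<open>t = 0\<close> is
  separate because \<open>0 powr x = 0\<close> does not come from the exponential formula.\<close>

lemma tendsto_powr_inverse_at_right_0:
  fixes t :: real
  assumes "0 \<le> t" "t < 1"
  shows "((\<lambda>h. t powr (1/h)) \<longlongrightarrow> 0) (at_right 0)"
proof (cases "t = 0")
  case False
  have "filterlim (\<lambda>h::real. 1/h) at_top (at_right 0)"
    using filterlim_inverse_at_top_right by (simp add: inverse_eq_divide)
  moreover have "ln t < 0"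
    using assms False by simp
  ultimately have "filterlim (\<lambda>h. ln t * (1/h)) at_bot (at_right 0)"
    by (intro filterlim_tendsto_neg_mult_at_bot[OF tendsto_const])
  then have "((\<lambda>h. exp (ln t * (1/h))) \<longlongrightarrow> 0) (at_right 0)"
    by (rule filterlim_compose[OF exp_at_bot])
  then show ?thesis
    using False by (simp add: powr_def mult.commute)
qed simp

text \<open>The parameter \<open>s\<close> serves both endpoints at once: \<open>s = 1\<close> gives
  the upper one and \<open>s = -1\<close> the lower one. After \<open>a\<close> is factored out, the
  base tends to 1 and the exponent to 0, so no indeterminate form arises.\<close>

lemma tendsto_powr_combination_at_right_0:
  fixes a b s :: real
  assumes "0 \<le> b" "b < a" "\<bar>s\<bar> \<le> 1"
  shows "((\<lambda>h. (a powr (1/h) + s * b powr (1/h)) powr h) \<longlongrightarrow> a) (at_right 0)"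
proof -
  define t where "t = b / a"
  have t: "0 \<le> t" "t < 1" and b: "b = a * t" and a: "0 < a"
    using assms by (auto simp: t_def)
  have "((\<lambda>h. a * (1 + s * t powr (1/h)) powr h) \<longlongrightarrow> a * (1 + s * 0) powr 0) (at_right 0)"
    by (intro tendsto_intros tendsto_powr tendsto_powr_inverse_at_right_0 t) auto
  then have lim: "((\<lambda>h. a * (1 + s * t powr (1/h)) powr h) \<longlongrightarrow> a) (at_right 0)"
    by simp
  have "(a powr (1/h) + s * b powr (1/h)) powr h = a * (1 + s * t powr (1/h)) powr h"
    if h: "0 < h" for h
  proof -
    have "t powr (1/h) \<le> 1"
      using t h by (simp add: powr_le1)
    then have "\<bar>s * t powr (1/h)\<bar> \<le> 1"
      using assms(3) by (simp add: abs_mult mult_le_one)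
    \<comment> \<open>With this factor nonnegative, the power \<open>h\<close> can be distributed
      over the product below.\<close>
    then have nonneg: "0 \<le> 1 + s * t powr (1/h)"
      by linarith
    have "a powr (1/h) + s * b powr (1/h) = a powr (1/h) * (1 + s * t powr (1/h))"
      using a t by (simp add: b powr_mult algebra_simps)
    then show ?thesis
      using nonneg a h by (simp add: powr_mult powr_powr)
  qed
  then have "\<forall>\<^sub>F h in at_right 0.
      a * (1 + s * t powr (1/h)) powr h = (a powr (1/h) + s * b powr (1/h)) powr h"
    by (intro eventually_mono[OF eventually_at_right_less[of "0::real"]]) simp
  then show ?thesis
    using lim by (rule tendsto_cong[THEN iffD1])
qed

lemma endpoints_tendsto_max:
  fixes a b :: real
  assumes "0 \<le> a" "0 \<le> b" "a \<noteq> b"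
  shows "((\<lambda>h. \<bar>a powr (1/h) - b powr (1/h)\<bar> powr h) \<longlongrightarrow> max a b) (at_right 0)"
    and "((\<lambda>h. (a powr (1/h) + b powr (1/h)) powr h) \<longlongrightarrow> max a b) (at_right 0)"
proof -
  \<comment> \<open>Both endpoint formulas are symmetric in the two numbers, so it is enough to
    treat a pair whose first entry is the larger one.\<close>
  have *: "((\<lambda>h. \<bar>x powr (1/h) - y powr (1/h)\<bar> powr h) \<longlongrightarrow> x) (at_right 0)
      \<and> ((\<lambda>h. (x powr (1/h) + y powr (1/h)) powr h) \<longlongrightarrow> x) (at_right 0)"
    if "0 \<le> y" "y < x" for x y :: real
  proof
    have "\<forall>\<^sub>F h in at_right 0. (x powr (1/h) + (-1) * y powr (1/h)) powr h
        = \<bar>x powr (1/h) - y powr (1/h)\<bar> powr h"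
      using eventually_at_right_less[of "0::real"]
    proof eventually_elim
      case (elim h)
      then have "y powr (1/h) \<le> x powr (1/h)"
        using that by (intro powr_mono2) auto
      then show ?case
        by simp
    qed
    then show "((\<lambda>h. \<bar>x powr (1/h) - y powr (1/h)\<bar> powr h) \<longlongrightarrow> x) (at_right 0)"
      using tendsto_powr_combination_at_right_0[OF that, of "-1"] tendsto_cong by force
    show "((\<lambda>h. (x powr (1/h) + y powr (1/h)) powr h) \<longlongrightarrow> x) (at_right 0)"
      using tendsto_powr_combination_at_right_0[OF that, of 1] by simp
  qed
  show "((\<lambda>h. \<bar>a powr (1/h) - b powr (1/h)\<bar> powr h) \<longlongrightarrow> max a b) (at_right 0)"
    and "((\<lambda>h. (a powr (1/h) + b powr (1/h)) powr h) \<longlongrightarrow> max a b) (at_right 0)"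
    using *[of a b] *[of b a] assms
    by (cases "a < b"; simp add: max_def abs_minus_commute add.commute)+
qed

text \<open>For equal arguments the ratio is 1 and its powers do not vanish in the limit. Instead,
  the expression equals \<open>2 powr h * a\<close> for \<open>h > 0\<close>, and
  \<open>2 powr h\<close> tends to 1.\<close>

lemma double_powr_tendsto:
  fixes a :: real
  assumes "0 \<le> a"
  shows "((\<lambda>h. (a powr (1/h) + a powr (1/h)) powr h) \<longlongrightarrow> a) (at_right 0)"
proof -
  have "((\<lambda>h. 2 powr h * a) \<longlongrightarrow> 2 powr 0 * a) (at_right 0)"
    by (intro tendsto_intros) auto
  moreover have "\<forall>\<^sub>F h in at_right 0. 2 powr h * a = (a powr (1/h) + a powr (1/h)) powr h"
    using eventually_at_right_less[of "0::real"]
  proof eventually_elim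
    case (elim h)
    have "(a powr (1/h) + a powr (1/h)) powr h = (2 * a powr (1/h)) powr h"
      by simp
    also have "\<dots> = 2 powr h * a"
      using elim assms by (simp add: powr_mult powr_powr del: mult_2)
    finally show ?case ..
  qed
  ultimately show ?thesis
    using tendsto_cong by force
qed

theorem mainTheorem4:
  fixes a b :: real
  assumes "0 \<le> a" and "0 \<le> b"
  shows "(\<forall>h>0. tri_add_h h a b =
            {c. 0 \<le> c \<and> \<bar>a powr (1/h) - b powr (1/h)\<bar> powr h \<le> c
                     \<and> c \<le> (a powr (1/h) + b powr (1/h)) powr h})
    \<and> (\<forall>h>0. segment_with_endpoints (tri_add_h h a b)
            (\<bar>a powr (1/h) - b powr (1/h)\<bar> powr h)
            ((a powr (1/h) + b powr (1/h)) powr h))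
    \<and> (\<exists>l u. segment_with_endpoints (ultra_add a b) l u
          \<and> ((\<lambda>h. \<bar>a powr (1/h) - b powr (1/h)\<bar> powr h) \<longlongrightarrow> l) (at_right 0)
          \<and> ((\<lambda>h. (a powr (1/h) + b powr (1/h)) powr h) \<longlongrightarrow> u) (at_right 0))
    \<and> (a \<noteq> b \<longrightarrow>
          ((\<lambda>h. \<bar>a powr (1/h) - b powr (1/h)\<bar> powr h) \<longlongrightarrow> max a b) (at_right 0)
        \<and> ((\<lambda>h. (a powr (1/h) + b powr (1/h)) powr h) \<longlongrightarrow> max a b) (at_right 0))
    \<and> (a = b \<longrightarrow>
          (\<forall>h>0. \<bar>a powr (1/h) - b powr (1/h)\<bar> powr h = 0)
        \<and> ((\<lambda>h. (a powr (1/h) + b powr (1/h)) powr h) \<longlongrightarrow> a) (at_right 0))"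
proof (intro conjI)
  let ?L = "\<lambda>h. \<bar>a powr (1/h) - b powr (1/h)\<bar> powr h"
  let ?U = "\<lambda>h. (a powr (1/h) + b powr (1/h)) powr h"
  show "\<forall>h>0. tri_add_h h a b = {c. 0 \<le> c \<and> ?L h \<le> c \<and> c \<le> ?U h}"
    \<comment> \<open>Nonnegativity of \<open>c\<close> follows from the lower bound, which is a
      value of \<open>powr\<close>.\<close>
    by (auto simp: tri_add_h_eq intro: order_trans[OF powr_ge_zero])
  have "?L h \<le> ?U h" if "0 < h" for h
    \<comment> \<open>The power \<open>h\<close> is increasing, and the absolute difference of two
      nonnegative numbers is at most their sum.\<close>
    using that by (intro powr_mono2) (auto simp: abs_le_iff add_increasing)
  then show "\<forall>h>0. segment_with_endpoints (tri_add_h h a b) (?L h) (?U h)"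
    by (simp add: segment_with_endpoints_def tri_add_h_eq)
  show neq: "a \<noteq> b \<longrightarrow> (?L \<longlongrightarrow> max a b) (at_right 0) \<and> (?U \<longlongrightarrow> max a b) (at_right 0)"
    using endpoints_tendsto_max[OF assms] by blast
  show eq: "a = b \<longrightarrow> (\<forall>h>0. ?L h = 0) \<and> (?U \<longlongrightarrow> a) (at_right 0)"
    using double_powr_tendsto[OF assms(1)] by auto
  show "\<exists>l u. segment_with_endpoints (ultra_add a b) l u
      \<and> (?L \<longlongrightarrow> l) (at_right 0) \<and> (?U \<longlongrightarrow> u) (at_right 0)"
  proof (cases "a = b")
    case True
    have "segment_with_endpoints (ultra_add a b) 0 a"
      using True assms by (auto simp: segment_with_endpoints_def ultra_add_def)
    then show ?thesis
      \<comment> \<open>On the diagonal \<open>?L\<close> is constantly 0, since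
        \<open>0 powr h = 0\<close>, which matches the left endpoint of
        \<open>[0, a]\<close>.\<close>
      using True eq by (intro exI[of _ 0] exI[of _ a]) auto
  next
    case False
    have "segment_with_endpoints (ultra_add a b) (max a b) (max a b)"
      using False by (simp add: segment_with_endpoints_def ultra_add_def)
    then show ?thesis
      using False neq by blast
  qed
qed

end
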